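(* A trajectory of type $CCCC$ is not a solution to Problem (Pc) (for its own endpoints, endpoint directions and length).
   Context: Problem (Pc): given $(x_0,y_0,\theta_0),(x_f,y_f,\theta_f)$ and a fixed $t_f>\|(x_0,y_0)-(x_f,y_f)\|$, minimize $a\ge0$ over $a$ and $u\in L^\infty(0,t_f;\mathbb R)$ subject to $\dot x=\cos\theta$, $\dot y=\sin\theta$, $\dot\theta=u$, $|u(t)|\le a$ for a.e. $t\in[0,t_f]$, $(x,y,\theta)(0)=(x_0,y_0,\theta_0)$, $(x,y,\theta)(t_f)=(x_f,y_f,\theta_f)$ (endpoint angles modulo $2\pi$). Equivalently: minimize the maximum curvature among unit-speed planar curves of length $t_f$ with prescribed endpoints and endpoint tangents. $C$ denotes a circular arc which is not closed (turning angle strictly between $0$ and $2\pi$). A trajectory of type $CCCC$ is a $C^1$ concatenation of four such arcs of positive length, consecutive arcs having opposite orientations (left turn / right turn), all with the same radius $1/a$, where $a$ is the maximum curvature of the trajectory. *)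

theory Defs
  imports "HOL-Analysis.Analysis" "HOL-Library.Real_Mod"
begin

text \<open>
  Absolutely continuous solutions of \<open>x' = cos \<theta>\<close>, \<open>y' = sin \<theta>\<close>, \<open>\<theta>' = u\<close> on \<open>[0, T]\<close> for an
  essentially bounded control \<open>u\<close>. Since \<open>\<theta>\<close> is continuous, \<open>x\<close> and \<open>y\<close> are automatically
  continuously differentiable, so only the equation for \<open>\<theta>\<close> needs the integral form.
\<close>
definition trajectory ::
  "real \<Rightarrow> (real \<Rightarrow> real) \<Rightarrow> (real \<Rightarrow> real) \<Rightarrow> (real \<Rightarrow> real) \<Rightarrow> (real \<Rightarrow> real) \<Rightarrow> bool" where
  "trajectory T u x y \<theta> \<longleftrightarrow>
     u \<in> borel_measurable (lebesgue_on {0..T}) \<and>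
     (\<exists>M. AE t in lebesgue_on {0..T}. \<bar>u t\<bar> \<le> M) \<and>
     (\<forall>t\<in>{0..T}.
        (x has_real_derivative cos (\<theta> t)) (at t within {0..T}) \<and>
        (y has_real_derivative sin (\<theta> t)) (at t within {0..T}) \<and>
        (u has_integral (\<theta> t - \<theta> 0)) {0..t})"

definition Pc_admissible ::
  "real \<Rightarrow> real \<times> real \<times> real \<Rightarrow> real \<times> real \<times> real \<Rightarrow> real \<Rightarrow> (real \<Rightarrow> real) \<Rightarrow> bool" where
  "Pc_admissible T = (\<lambda>(x0, y0, \<theta>0) (xf, yf, \<theta>f) a u.
     0 \<le> a \<and> (AE t in lebesgue_on {0..T}. \<bar>u t\<bar> \<le> a) \<and>
     (\<exists>x y \<theta>. trajectory T u x y \<theta> \<and>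
        x 0 = x0 \<and> y 0 = y0 \<and> [\<theta> 0 = \<theta>0] (rmod (2 * pi)) \<and>
        x T = xf \<and> y T = yf \<and> [\<theta> T = \<theta>f] (rmod (2 * pi))))"

text \<open>
  The standing requirement that \<open>T\<close> exceeds the distance of the endpoints is not part of this
  definition; it holds for the trajectories considered here by \<open>CCCC_length_gt_dist\<close> below.
\<close>
definition Pc_solution ::
  "real \<Rightarrow> real \<times> real \<times> real \<Rightarrow> real \<times> real \<times> real \<Rightarrow> real \<Rightarrow> (real \<Rightarrow> real) \<Rightarrow> bool" where
  "Pc_solution T q0 qf a u \<longleftrightarrow>
     Pc_admissible T q0 qf a u \<and> (\<forall>b v. Pc_admissible T q0 qf b v \<longrightarrow> a \<le> b)"

text \<open>
  On \<open>[s, t]\<close> the curve \<open>(x, y)\<close> runs at unit speed along a circular arc of radius \<open>r\<close> with turning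
  angle \<open>(t - s) / r\<close> strictly between \<open>0\<close> and \<open>2 * pi\<close>; \<open>\<epsilon> = 1\<close> is a left turn
  (counterclockwise), \<open>\<epsilon> = -1\<close> a right turn.
\<close>
definition circular_arc ::
  "real \<Rightarrow> real \<Rightarrow> real \<Rightarrow> real \<Rightarrow> (real \<Rightarrow> real) \<Rightarrow> (real \<Rightarrow> real) \<Rightarrow> bool" where
  "circular_arc \<epsilon> r s t x y \<longleftrightarrow>
     0 < r \<and> s < t \<and> (t - s) / r < 2 * pi \<and>
     (\<exists>cx cy \<phi>. \<forall>\<tau>\<in>{s..t}.
        x \<tau> = cx + r * cos (\<phi> + \<epsilon> * (\<tau> - s) / r) \<and>
        y \<tau> = cy + r * sin (\<phi> + \<epsilon> * (\<tau> - s) / r))"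

text \<open>
  The concatenation is \<open>C\<^sup>1\<close> because \<open>\<theta>\<close> is continuous along a trajectory.
\<close>
definition CCCC_trajectory ::
  "real \<Rightarrow> real \<Rightarrow> (real \<Rightarrow> real) \<Rightarrow> (real \<Rightarrow> real) \<Rightarrow> (real \<Rightarrow> real) \<Rightarrow> (real \<Rightarrow> real) \<Rightarrow> bool" where
  "CCCC_trajectory T a u x y \<theta> \<longleftrightarrow>
     trajectory T u x y \<theta> \<and> 0 < a \<and>
     (\<exists>\<epsilon>\<in>{1, -1}. \<exists>s1 s2 s3.
        circular_arc \<epsilon> (1 / a) 0 s1 x y \<and>
        circular_arc (- \<epsilon>) (1 / a) s1 s2 x y \<and>
        circular_arc \<epsilon> (1 / a) s2 s3 x y \<and>
        circular_arc (- \<epsilon>) (1 / a) s3 T x y)"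

lemma arc_derivative:
  fixes r :: real
  assumes "0 < r" "s < t" "t \<le> T" "0 \<le> s"
    and arc: "\<And>\<tau>. \<tau> \<in> {s..t} \<Longrightarrow> x \<tau> = cx + r * cos (\<phi> + \<epsilon> * (\<tau> - s) / r)"
    and d: "(x has_real_derivative D) (at \<tau> within {0..T})" and "\<tau> \<in> {s..t}"
  shows "D = - \<epsilon> * sin (\<phi> + \<epsilon> * (\<tau> - s) / r)"
proof -
  have "(x has_real_derivative D) (at \<tau> within {s..t})"
    using d by (rule DERIV_subset) (use assms in auto)
  moreover have "(x has_real_derivative - \<epsilon> * sin (\<phi> + \<epsilon> * (\<tau> - s) / r)) (at \<tau> within {s..t})"
  proof (rule has_field_derivative_transform_within[where d = 1])
    show "((\<lambda>\<tau>. cx + r * cos (\<phi> + \<epsilon> * (\<tau> - s) / r)) has_real_derivative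
        - \<epsilon> * sin (\<phi> + \<epsilon> * (\<tau> - s) / r)) (at \<tau> within {s..t})"
      using \<open>0 < r\<close> by (auto intro!: derivative_eq_intros)
  qed (use arc \<open>\<tau> \<in> {s..t}\<close> in auto)
  ultimately show ?thesis
    using \<open>\<tau> \<in> {s..t}\<close> \<open>s < t\<close>
    by (metis atLeastAtMost_iff box_real(2) has_real_derivative_iff_has_vector_derivative
        vector_derivative_unique_within_closed_interval)
qed

lemma CCCC_length_gt_dist:
  assumes "CCCC_trajectory T a u x y \<theta>"
  shows "T > dist (x 0, y 0) (x T, y T)"
proof (rule ccontr)
  assume neg: "\<not> ?thesis"
  define d where "d = dist (x 0, y 0) (x T, y T)"
  have Td: "T \<le> d" using neg by (simp add: d_def)
  from assms obtain \<epsilon> s1 s2 s3 where tr: "trajectory T u x y \<theta>" and a: "0 < a"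
    and \<epsilon>: "\<epsilon> \<in> {1, -1}" and c1: "circular_arc \<epsilon> (1 / a) 0 s1 x y"
    and "s1 < s2" "s2 < s3" "s3 < T"
    unfolding CCCC_trajectory_def circular_arc_def by blast
  then have s1: "0 < s1" "s1 < T" and ang: "a * s1 < 2 * pi"
    by (auto simp: circular_arc_def mult.commute)
  have dx: "(x has_real_derivative cos (\<theta> t)) (at t within {0..T})"
    and dy: "(y has_real_derivative sin (\<theta> t)) (at t within {0..T})" if "t \<in> {0..T}" for t
    using tr that unfolding trajectory_def by blast+
  have dpos: "0 < d" using Td s1 by simp
  define c s where "c = (x T - x 0) / d" and "s = (y T - y 0) / d"
  have dd: "d\<^sup>2 = (x T - x 0)\<^sup>2 + (y T - y 0)\<^sup>2"
    by (simp add: d_def dist_Pair_Pair dist_real_def power2_commute)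
  have cs: "c\<^sup>2 + s\<^sup>2 = 1"
    using dpos by (simp add: c_def s_def power_divide flip: add_divide_distrib dd)
  define g where "g t = t - (c * (x t - x 0) + s * (y t - y 0))" for t
  have le1: "c * cos \<alpha> + s * sin \<alpha> \<le> 1" for \<alpha>
  proof -
    have "0 \<le> (c - cos \<alpha>)\<^sup>2 + (s - sin \<alpha>)\<^sup>2" by simp
    also have "\<dots> = (c\<^sup>2 + s\<^sup>2) + ((sin \<alpha>)\<^sup>2 + (cos \<alpha>)\<^sup>2) - 2 * (c * cos \<alpha> + s * sin \<alpha>)"
      by (simp add: power2_eq_square algebra_simps)
    finally show ?thesis using cs by simp
  qed
  have dg: "(g has_real_derivative 1 - (c * cos (\<theta> t) + s * sin (\<theta> t))) (at t within {0..T})"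
    if "t \<in> {0..T}" for t
    unfolding g_def by (auto intro!: derivative_eq_intros dx dy that)
  have mono: "g p \<le> g q" if pq: "0 \<le> p" "p \<le> q" "q \<le> T" for p q
  proof (rule DERIV_nonneg_imp_increasing_open[of p q g])
    show "p \<le> q" by fact
    show "continuous_on {p..q} g"
      using DERIV_continuous_on[of "{0..T}" g, OF dg] continuous_on_subset pq
      by (meson atLeastatMost_subset_iff)
    show "\<exists>D. (g has_real_derivative D) (at t) \<and> D \<ge> 0" if "p < t" "t < q" for t
    proof -
      have t: "t \<in> {0..T}" "t \<in> interior {0..T}"
        using pq that by auto
      have "(g has_real_derivative 1 - (c * cos (\<theta> t) + s * sin (\<theta> t))) (at t)"
        using dg[OF t(1)] at_within_interior[OF t(2)] by simp
      then show ?thesis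
        using le1[of "\<theta> t"] by (intro exI[of _ "1 - (c * cos (\<theta> t) + s * sin (\<theta> t))"]) auto
    qed
  qed
  have "c * (x T - x 0) + s * (y T - y 0) = ((x T - x 0)\<^sup>2 + (y T - y 0)\<^sup>2) / d"
    by (simp add: c_def s_def power2_eq_square add_divide_distrib)
  also have "\<dots> = d"
    using dpos dd by (simp only: dd[symmetric]) (simp add: power2_eq_square)
  finally have "c * (x T - x 0) + s * (y T - y 0) = d" .
  then have "g T \<le> g 0"
    using Td by (simp add: g_def)
  then have g0: "g t = g 0" if "t \<in> {0..T}" for t
    using mono[of 0 t] mono[of t T] that by auto
  have dir: "cos (\<theta> t) = c \<and> sin (\<theta> t) = s" if "t \<in> {0..T}" for t
  proof -
    have "(g has_real_derivative 0) (at t within {0..T})"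
    proof (rule has_field_derivative_transform_within[where d = 1])
      show "((\<lambda>_. g 0) has_real_derivative 0) (at t within {0..T})" by simp
      show "g 0 = g t'" if "t' \<in> {0..T}" for t' using g0[OF that] by (rule sym)
    qed (use that in simp_all)
    then have "1 - (c * cos (\<theta> t) + s * sin (\<theta> t)) = 0"
      using vector_derivative_unique_within_closed_interval[of 0 T t g] dg[OF that] that s1
      unfolding has_real_derivative_iff_has_vector_derivative
      by (metis box_real(2) less_trans)
    moreover have "(c - cos (\<theta> t))\<^sup>2 + (s - sin (\<theta> t))\<^sup>2 =
        (c\<^sup>2 + s\<^sup>2) + ((sin (\<theta> t))\<^sup>2 + (cos (\<theta> t))\<^sup>2) - 2 * (c * cos (\<theta> t) + s * sin (\<theta> t))"
      by (simp add: power2_eq_square algebra_simps)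
    ultimately have "(c - cos (\<theta> t))\<^sup>2 + (s - sin (\<theta> t))\<^sup>2 = 0"
      using cs by simp
    then show ?thesis
      by (simp add: sum_power2_eq_zero_iff)
  qed
  obtain cx cy \<phi> where
    ax: "\<And>\<tau>. \<tau> \<in> {0..s1} \<Longrightarrow> x \<tau> = cx + (1 / a) * cos (\<phi> + \<epsilon> * (\<tau> - 0) / (1 / a))" and
    ay: "\<And>\<tau>. \<tau> \<in> {0..s1} \<Longrightarrow> y \<tau> = cy + (1 / a) * sin (\<phi> + \<epsilon> * (\<tau> - 0) / (1 / a))"
    using c1 unfolding circular_arc_def by blast
  have ay': "y \<tau> = cy + (1 / a) * cos ((\<phi> - pi / 2) + \<epsilon> * (\<tau> - 0) / (1 / a))"
    if "\<tau> \<in> {0..s1}" for \<tau>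
  proof -
    have "cos ((\<phi> - pi / 2) + z) = sin (\<phi> + z)" for z
      by (simp add: sin_add cos_add sin_diff cos_diff)
    then show ?thesis using ay[OF that] by simp
  qed
  have X: "c = - \<epsilon> * sin (\<phi> + \<epsilon> * \<tau> * a)" and Y: "s = \<epsilon> * cos (\<phi> + \<epsilon> * \<tau> * a)"
    if "\<tau> \<in> {0..s1}" for \<tau>
  proof -
    have t: "\<tau> \<in> {0..T}" using that s1 by auto
    have "cos (\<theta> \<tau>) = - \<epsilon> * sin (\<phi> + \<epsilon> * (\<tau> - 0) / (1 / a))"
      by (rule arc_derivative[OF _ _ _ _ ax dx[OF t] that]) (use a s1 in auto)
    then show "c = - \<epsilon> * sin (\<phi> + \<epsilon> * \<tau> * a)" using dir[OF t] by simp
    have "sin (\<theta> \<tau>) = - \<epsilon> * sin ((\<phi> - pi / 2) + \<epsilon> * (\<tau> - 0) / (1 / a))"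
      by (rule arc_derivative[OF _ _ _ _ ay' dy[OF t] that]) (use a s1 in auto)
    moreover have "sin ((\<phi> - pi / 2) + z) = - cos (\<phi> + z)" for z
      by (simp add: sin_add cos_add sin_diff cos_diff)
    ultimately show "s = \<epsilon> * cos (\<phi> + \<epsilon> * \<tau> * a)" using dir[OF t] by simp
  qed
  have "sin (\<phi> + \<epsilon> * s1 * a) = sin \<phi> \<and> cos (\<phi> + \<epsilon> * s1 * a) = cos \<phi>"
    using X[of 0] X[of s1] Y[of 0] Y[of s1] s1 \<epsilon> by auto
  then obtain n :: int where "\<phi> + \<epsilon> * s1 * a = \<phi> + 2 * pi * n"
    unfolding sin_cos_eq_iff by blast
  then have "\<epsilon> * (a * s1) = 2 * pi * n" by (simp add: ac_simps)
  then have n: "a * s1 = 2 * pi * \<bar>real_of_int n\<bar>"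
  proof -
    have "\<bar>\<epsilon> * (a * s1)\<bar> = a * s1" using \<epsilon> a s1 by (auto simp: abs_mult)
    then show ?thesis using \<open>\<epsilon> * (a * s1) = 2 * pi * n\<close> by (simp add: abs_mult)
  qed
  have "0 < a * s1" using a s1 by simp
  then have "n \<noteq> 0" using n by auto
  then have "1 \<le> \<bar>real_of_int n\<bar>" by linarith
  then have "2 * pi * 1 \<le> 2 * pi * \<bar>real_of_int n\<bar>"
    by (intro mult_left_mono) auto
  then show False using n ang by simp
qed

end

theory Submission
  imports Defs
begin

text \<open>
  Write the curve in terms of its headings. With \<open>f h = (sin h, - cos h, h)\<close>, an arc of radius \<open>r\<close>
  that turns left from heading \<open>p\<close> to \<open>q\<close> contributes \<open>r (f q - f p)\<close> to the triple
  (displacement in \<open>x\<close>, displacement in \<open>y\<close>, length), and a right turn contributes \<open>r (f p - f q)\<close>.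
  So four alternating arcs with end headings \<open>e0\<close>, \<open>e4\<close> and headings \<open>h1, h2, h3\<close> at the switches
  have the right endpoints and length iff three real equations in \<open>h1, h2, h3\<close> and the radii hold. It
  suffices to find, near the given solution with all radii \<open>r = 1 / a\<close>, one whose radii all exceed
  \<open>r\<close>: nearby headings keep all four arcs of positive length, and the new curve has maximum
  curvature below \<open>a\<close>.

  Differentiating in the switch headings gives the vectors \<open>(cos h, sin h, 1)\<close> at \<open>h1, h2, h3\<close>.
  These are light-like for the form \<open>x x' + y y' - z z'\<close>, hence independent when the headings are
  distinct modulo \<open>2 * pi\<close>. As the inner arcs turn by less than \<open>2 * pi\<close>, this fails only for
  \<open>h1 = h3\<close>, that is, for equal inner arcs. If \<open>h1 \<noteq> h3\<close>, a common increase of the radii can be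
  compensated by the headings (\<open>enlarge_regular\<close>).

  If \<open>h1 = h3 = h\<close>, moving \<open>h1, h3\<close> to \<open>h + \<alpha>, h - \<alpha>\<close> has no first-order effect, but
  \<open>f (h + \<alpha>) + f (h - \<alpha>) = 2 f h + 2 (cos \<alpha> - 1) (sin h, - cos h, 0)\<close> leaves the plane spanned by the
  other two derivatives to second order, always towards the same side. An increase of the radii can be
  compensated if it pushes towards the opposite side. Enlarging the two inner arcs does so, by
  \<open>\<mu> cos \<mu> < sin \<mu>\<close> for the half turning angle \<open>\<mu>\<close> of an inner arc; enlarging the outer arcs may not,
  so the inner radii are made to grow faster by a large factor (\<open>enlarge_critical\<close>).

  In both cases the perturbation is linear algebra plus one analytic fact,
  \<open>zero_persists_with_slope\<close>: solutions of the linearised equation are the slopes of actual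
  solutions. The slope is needed in the critical case, where the unknown \<open>cos \<alpha> - 1\<close> must come out
  negative.
\<close>

section \<open>Solutions with a prescribed slope\<close>

text \<open>
  A form of the implicit function theorem that needs differentiability at one point only, besides
  continuity. In the rescaled unknown \<open>\<xi> = (x - x0) / \<rho>\<close> the equation \<open>F (\<rho>, x) = F (0, x0)\<close> becomes
  \<open>R + M \<xi> + o(1) = 0\<close>, uniformly on a ball about the solution \<open>\<xi>0\<close> of \<open>R + M \<xi>0 = 0\<close>. Brouwer's
  fixed point theorem gives a solution in that ball, so its slope \<open>\<xi>\<close> is close to \<open>\<xi>0\<close>.
\<close>
lemma zero_persists_with_slope:
  fixes F :: "real \<times> 'a::euclidean_space \<Rightarrow> 'a"
  assumes cont: "continuous_on UNIV F"
    and der: "(F has_derivative (\<lambda>(\<delta>, \<xi>). \<delta> *\<^sub>R R + M \<xi>)) (at (0, x0))"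
    and M: "linear M" "inj M"
  shows "\<exists>\<xi>0. M \<xi>0 = - R \<and> (\<forall>e>0. \<exists>\<rho> \<xi>. 0 < \<rho> \<and> \<rho> < e \<and> norm (\<xi> - \<xi>0) < e \<and>
    norm (\<rho> *\<^sub>R \<xi>) < e \<and> F (\<rho>, x0 + \<rho> *\<^sub>R \<xi>) = F (0, x0))"
proof -
  have "surj M" by (rule linear_inj_imp_surj[OF M])
  then obtain g where g: "linear g" "M \<circ> g = id"
    using linear_surjective_right_inverse[OF M(1)] by blast
  have Mg: "M (g z) = z" for z using g(2) by (metis comp_apply id_apply)
  define \<xi>0 where "\<xi>0 = g (- R)"
  obtain B where B: "B > 0" "\<And>z. norm (g z) \<le> B * norm z"
    using linear_bounded_pos[OF g(1)] by blast
  have "\<exists>\<rho> \<xi>. 0 < \<rho> \<and> \<rho> < e \<and> norm (\<xi> - \<xi>0) < e \<and>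
      norm (\<rho> *\<^sub>R \<xi>) < e \<and> F (\<rho>, x0 + \<rho> *\<^sub>R \<xi>) = F (0, x0)" if "e > 0" for e
  proof -
    define d where "d = e / (2 * B)"
    define K where "K = 1 + norm \<xi>0 + e"
    have dK: "d > 0" "K \<ge> 1" using that B by (auto simp: d_def K_def)
    have gd: "norm (g \<zeta>) < e" if "\<zeta> \<in> cball 0 d" for \<zeta>
    proof -
      have "norm (g \<zeta>) \<le> B * d"
        using B(2)[of \<zeta>] that B(1) by (smt (verit) mem_cball_0 mult_left_mono)
      also have "\<dots> < e" using B(1) \<open>e > 0\<close> by (simp add: d_def)
      finally show ?thesis .
    qed
    have "d / K > 0" using dK by simp
    obtain t where t: "t > 0" "\<And>z. norm (z - (0, x0)) < t \<Longrightarrow>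
        norm (F z - F (0, x0) - (case z - (0, x0) of (\<delta>, \<xi>) \<Rightarrow> \<delta> *\<^sub>R R + M \<xi>))
          \<le> d / K * norm (z - (0, x0))"
      using der \<open>d / K > 0\<close> unfolding has_derivative_at_alt by blast
    define \<rho> where "\<rho> = min t e / (2 * K)"
    have \<rho>K: "\<rho> * K = min t e / 2" "\<rho> > 0" using that t dK by (auto simp: \<rho>_def)
    have \<rho>: "\<rho> > 0" "\<rho> < e" "\<rho> * K < t" "\<rho> * K < e"
    proof -
      show "\<rho> > 0" "\<rho> * K < t" "\<rho> * K < e" using that t \<rho>K by auto
      moreover have "\<rho> * 1 \<le> \<rho> * K" using \<rho>K dK by (intro mult_left_mono) auto
      ultimately show "\<rho> < e" by linarith
    qed
    define \<Phi> where "\<Phi> \<zeta> = F (\<rho>, x0 + \<rho> *\<^sub>R (\<xi>0 + g \<zeta>)) - F (0, x0)" for \<zeta>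
    have nK: "norm (1 :: real, \<xi>0 + g \<zeta>) \<le> K" "norm (\<xi>0 + g \<zeta>) \<le> K" if "\<zeta> \<in> cball 0 d" for \<zeta>
    proof -
      have "norm (\<xi>0 + g \<zeta>) \<le> norm \<xi>0 + e"
        using gd[OF that] norm_triangle_ineq[of \<xi>0 "g \<zeta>"] by linarith
      then show "norm (1 :: real, \<xi>0 + g \<zeta>) \<le> K" "norm (\<xi>0 + g \<zeta>) \<le> K"
        using norm_Pair_le[of "1 :: real" "\<xi>0 + g \<zeta>"] by (auto simp: K_def)
    qed
    have "\<exists>\<zeta>\<in>cball 0 d. \<zeta> - (1 / \<rho>) *\<^sub>R \<Phi> \<zeta> = \<zeta>"
    proof (rule brouwer_ball)
      show "d > 0" by fact
      have "continuous_on S g" for S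
        using g(1) by (simp add: linear_continuous_on linear_linear)
      then show "continuous_on (cball 0 d) (\<lambda>\<zeta>. \<zeta> - (1 / \<rho>) *\<^sub>R \<Phi> \<zeta>)"
        unfolding \<Phi>_def
        by (intro continuous_intros continuous_on_compose2[OF cont]) auto
      show "(\<lambda>\<zeta>. \<zeta> - (1 / \<rho>) *\<^sub>R \<Phi> \<zeta>) \<in> cball 0 d \<rightarrow> cball 0 d"
      proof
        fix \<zeta> :: 'a assume \<zeta>: "\<zeta> \<in> cball 0 d"
        define z where "z = (\<rho>, x0 + \<rho> *\<^sub>R (\<xi>0 + g \<zeta>))"
        have z: "z - (0, x0) = \<rho> *\<^sub>R (1, \<xi>0 + g \<zeta>)" by (simp add: z_def)
        have nz: "norm (z - (0, x0)) \<le> \<rho> * K"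
          unfolding z norm_scaleR using nK(1)[OF \<zeta>] \<rho>(1)
          by (simp only: abs_of_pos mult_le_cancel_left_pos)
        have L: "(case z - (0, x0) of (\<delta>, \<xi>) \<Rightarrow> \<delta> *\<^sub>R R + M \<xi>) = \<rho> *\<^sub>R \<zeta>"
        proof -
          have "(case z - (0, x0) of (\<delta>, \<xi>) \<Rightarrow> \<delta> *\<^sub>R R + M \<xi>) = \<rho> *\<^sub>R R + M (\<rho> *\<^sub>R (\<xi>0 + g \<zeta>))"
            unfolding z by simp
          also have "\<dots> = \<rho> *\<^sub>R (R + (M \<xi>0 + M (g \<zeta>)))"
            by (simp only: linear_cmul[OF M(1)] linear_add[OF M(1)] scaleR_add_right)
          also have "\<dots> = \<rho> *\<^sub>R \<zeta>" by (simp add: \<xi>0_def Mg)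
          finally show ?thesis .
        qed
        have "norm (\<Phi> \<zeta> - \<rho> *\<^sub>R \<zeta>) \<le> d / K * norm (z - (0, x0))"
          using t(2)[of z] nz \<rho>(3) unfolding L by (simp add: \<Phi>_def z_def)
        also have "\<dots> \<le> d / K * (\<rho> * K)"
          using nz dK by (intro mult_left_mono) auto
        finally have "norm (\<Phi> \<zeta> - \<rho> *\<^sub>R \<zeta>) \<le> \<rho> * d" using dK by (simp add: mult.commute)
        then have "norm (\<Phi> \<zeta> - \<rho> *\<^sub>R \<zeta>) / \<rho> \<le> d"
          using \<rho>(1) by (simp only: pos_divide_le_eq mult.commute)
        moreover have "\<zeta> - (1 / \<rho>) *\<^sub>R \<Phi> \<zeta> = - ((1 / \<rho>) *\<^sub>R (\<Phi> \<zeta> - \<rho> *\<^sub>R \<zeta>))"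
          using \<rho>(1) by (simp add: algebra_simps)
        then have "norm (\<zeta> - (1 / \<rho>) *\<^sub>R \<Phi> \<zeta>) = norm (\<Phi> \<zeta> - \<rho> *\<^sub>R \<zeta>) / \<rho>"
          using \<rho>(1) by (simp only: norm_minus_cancel norm_scaleR) simp
        ultimately show "\<zeta> - (1 / \<rho>) *\<^sub>R \<Phi> \<zeta> \<in> cball 0 d"
          by simp
      qed
    qed blast
    then obtain \<zeta> where \<zeta>: "\<zeta> \<in> cball 0 d" "\<Phi> \<zeta> = 0"
      using \<rho>(1) by auto
    have "norm (\<rho> *\<^sub>R (\<xi>0 + g \<zeta>)) \<le> \<rho> * K"
      using nK[OF \<zeta>(1)] \<rho>(1) by simp
    then have "norm (\<rho> *\<^sub>R (\<xi>0 + g \<zeta>)) < e" using \<rho>(4) by linarith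
    then show ?thesis
      using \<rho> gd[OF \<zeta>(1)] \<zeta>(2) unfolding \<Phi>_def
      by (intro exI[of _ \<rho>] exI[of _ "\<xi>0 + g \<zeta>"]) auto
  qed
  moreover have "M \<xi>0 = - R" by (simp add: \<xi>0_def Mg)
  ultimately show ?thesis by blast
qed

section \<open>Independence of tangents to the helix\<close>

definition helix :: "real \<Rightarrow> real \<times> real \<times> real" where
  "helix h = (sin h, - cos h, h)"

definition helix' :: "real \<Rightarrow> real \<times> real \<times> real" where
  "helix' h = (cos h, sin h, 1)"

lemma helix_has_derivative [derivative_intros]:
  assumes "(g has_derivative g') (at x within S)"
  shows "((\<lambda>x. helix (g x)) has_derivative (\<lambda>d. g' d *\<^sub>R helix' (g x))) (at x within S)"
  unfolding helix_def helix'_def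
  by (auto intro!: derivative_eq_intros assms simp: fun_eq_iff mult.commute)

lemma continuous_on_helix [continuous_intros]:
  fixes g :: "'a::t2_space \<Rightarrow> real"
  shows   "continuous_on S g \<Longrightarrow> continuous_on S (\<lambda>x. helix (g x))"
  unfolding helix_def
  by (intro continuous_on_Pair continuous_on_minus continuous_on_sin continuous_on_cos)

lemma cos_less_1:
  fixes z :: real
  assumes "z \<noteq> 0" "\<bar>z\<bar> < 2 * pi"
  shows "cos z < 1"
proof -
  have "cos z \<noteq> 1"
  proof
    assume "cos z = 1"
    then obtain n :: int where n: "z = of_int n * 2 * pi" using cos_one_2pi_int by auto
    then have "\<bar>of_int n\<bar> * (2 * pi) < 1 * (2 * pi)" using assms by (simp add: abs_mult)
    then have "\<bar>of_int n :: real\<bar> < 1" by (subst (asm) mult_less_cancel_right_pos) auto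
    then have "n = 0" by linarith
    then show False using n assms by simp
  qed
  then show ?thesis using cos_le_one[of z] by linarith
qed

text \<open>
  Pairing the relation with the three vectors themselves under the Lorentz form gives a symmetric
  \<open>3 \<times> 3\<close> system with zero diagonal and the entries \<open>cos (p - q) - 1\<close>, \<open>cos (p - r) - 1\<close>,
  \<open>cos (q - r) - 1\<close> off it. Its determinant is twice their product.
\<close>
lemma helix'_independent:
  assumes 0: "\<alpha> *\<^sub>R helix' p + \<beta> *\<^sub>R helix' q + \<gamma> *\<^sub>R helix' r = 0"
    and pq: "cos (p - q) \<noteq> 1" and pr: "cos (p - r) \<noteq> 1" and qr: "cos (q - r) \<noteq> 1"
  shows "\<alpha> = 0 \<and> \<beta> = 0 \<and> \<gamma> = 0"
proof -
  have c: "\<alpha> * cos p + \<beta> * cos q + \<gamma> * cos r = 0"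
    and s: "\<alpha> * sin p + \<beta> * sin q + \<gamma> * sin r = 0" and l: "\<alpha> + \<beta> + \<gamma> = 0"
    using 0 by (auto simp: helix'_def zero_prod_def)
  have E: "\<alpha> * (cos (z - p) - 1) + \<beta> * (cos (z - q) - 1) + \<gamma> * (cos (z - r) - 1) = 0" for z
  proof -
    have "\<alpha> * (cos (z - p) - 1) + \<beta> * (cos (z - q) - 1) + \<gamma> * (cos (z - r) - 1) =
      cos z * (\<alpha> * cos p + \<beta> * cos q + \<gamma> * cos r) + sin z * (\<alpha> * sin p + \<beta> * sin q + \<gamma> * sin r)
      - (\<alpha> + \<beta> + \<gamma>)"
      by (simp add: cos_diff algebra_simps)
    then show ?thesis by (simp add: c s l)
  qed
  define A B C where "A = cos (p - q) - 1" and "B = cos (p - r) - 1" and "C = cos (q - r) - 1"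
  have sym: "cos (q - p) - 1 = A" "cos (r - p) - 1 = B" "cos (r - q) - 1 = C"
    unfolding A_def B_def C_def by (metis cos_minus minus_diff_eq)+
  have e1: "\<beta> * A + \<gamma> * B = 0" and e2: "\<alpha> * A + \<gamma> * C = 0" and e3: "\<alpha> * B + \<beta> * C = 0"
    using E[of p] E[of q] E[of r] by (simp_all add: sym flip: A_def B_def C_def)
  have nz: "A \<noteq> 0" "B \<noteq> 0" "C \<noteq> 0" using pq pr qr by (auto simp: A_def B_def C_def)
  have "2 * \<gamma> * (B * C) = 0" using e1 e2 e3 by algebra
  then have "\<gamma> = 0" using nz by simp
  then show ?thesis using e1 e2 nz by simp
qed

section \<open>Enlarging the radii of four alternating arcs\<close>

text \<open>
  Displacement and length of a left-right-left-right curve with the outer radius \<open>R\<close>, the inner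
  radius \<open>S\<close>, the end headings \<open>e0\<close>, \<open>e4\<close> and the headings \<open>h1, h2, h3\<close> at the switches.
\<close>
abbreviation four_arcs ::
  "real \<Rightarrow> real \<Rightarrow> real \<Rightarrow> real \<Rightarrow> real \<Rightarrow> real \<Rightarrow> real \<Rightarrow> real \<times> real \<times> real" where
  "four_arcs R S e0 h1 h2 h3 e4 \<equiv>
     R *\<^sub>R (helix h1 - helix e0) + S *\<^sub>R (helix h1 - helix h2) +
     S *\<^sub>R (helix h3 - helix h2) + R *\<^sub>R (helix h3 - helix e4)"

text \<open>
  Distinct \<open>h1\<close> and \<open>h3\<close> in the interval \<open>(h2, h2 + 2 * pi)\<close> and \<open>h2\<close> itself are pairwise distinct
  modulo \<open>2 * pi\<close>. So the derivative in the three headings is invertible, and all four radii can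
  grow at the same rate.
\<close>
lemma enlarge_regular:
  assumes r: "0 < r" and ord: "e0 < h1" "h2 < h1" "h2 < h3" "e4 < h3"
    and turn: "h1 - h2 < 2 * pi" "h3 - h2 < 2 * pi" and ne: "h1 \<noteq> h3"
  shows "\<exists>R S k1 k2 k3. r < R \<and> R \<le> S \<and> e0 < k1 \<and> k2 < k1 \<and> k2 < k3 \<and> e4 < k3 \<and>
    four_arcs R S e0 k1 k2 k3 e4 = four_arcs r r e0 h1 h2 h3 e4"
proof -
  define Q where "Q h1 h2 h3 = 2 *\<^sub>R helix h1 - 2 *\<^sub>R helix h2 + 2 *\<^sub>R helix h3 - helix e0 - helix e4"
    for h1 h2 h3
  have four: "four_arcs R R e0 k1 k2 k3 e4 = R *\<^sub>R Q k1 k2 k3" for R k1 k2 k3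
    by (simp add: Q_def algebra_simps scaleR_2)
  define F where "F z = (r + fst z) *\<^sub>R Q (fst (snd z)) (fst (snd (snd z))) (snd (snd (snd z)))"
    for z :: "real \<times> real \<times> real \<times> real"
  define M where "M \<xi> = (2 * r) *\<^sub>R (fst \<xi> *\<^sub>R helix' h1 + (- fst (snd \<xi>)) *\<^sub>R helix' h2 +
      snd (snd \<xi>) *\<^sub>R helix' h3)" for \<xi> :: "real \<times> real \<times> real"
  have cont: "continuous_on UNIV F"
    unfolding F_def Q_def by (intro continuous_intros)
  have der: "(F has_derivative (\<lambda>(\<delta>, \<xi>). \<delta> *\<^sub>R Q h1 h2 h3 + M \<xi>)) (at (0, (h1, h2, h3)))"
    unfolding F_def Q_def M_def
    by (rule derivative_eq_intros refl)+ (auto simp: fun_eq_iff algebra_simps)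
  have M: "linear M"
    unfolding M_def by (rule linearI) (auto simp: algebra_simps)
  moreover have "inj M"
  proof (rule iffD2[OF linear_injective_0[OF M]], safe)
    fix \<alpha> \<beta> \<gamma> assume "M (\<alpha>, \<beta>, \<gamma>) = 0"
    then have "\<alpha> *\<^sub>R helix' h1 + (- \<beta>) *\<^sub>R helix' h2 + \<gamma> *\<^sub>R helix' h3 = 0"
      unfolding M_def using r by (simp del: scaleR_minus_left)
    then have "\<alpha> = 0 \<and> - \<beta> = 0 \<and> \<gamma> = 0"
    proof (rule helix'_independent)
      have "\<bar>h1 - h3\<bar> < 2 * pi" using ord turn by linarith
      then show "cos (h1 - h2) \<noteq> 1" "cos (h1 - h3) \<noteq> 1" "cos (h2 - h3) \<noteq> 1"
        using cos_less_1[of "h1 - h2"] cos_less_1[of "h1 - h3"] cos_less_1[of "h2 - h3"]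
          ord turn ne by auto
    qed
    then show "(\<alpha>, \<beta>, \<gamma>) = 0" by (simp add: zero_prod_def)
  qed
  ultimately obtain \<xi>0 where *: "\<And>e. e > 0 \<Longrightarrow> \<exists>\<rho> \<xi>. 0 < \<rho> \<and> \<rho> < e \<and> norm (\<xi> - \<xi>0) < e \<and>
    norm (\<rho> *\<^sub>R \<xi>) < e \<and> F (\<rho>, (h1, h2, h3) + \<rho> *\<^sub>R \<xi>) = F (0, (h1, h2, h3))"
    using zero_persists_with_slope[OF cont der] by blast
  define e where "e = Min {h1 - e0, h1 - h2, h3 - h2, h3 - e4} / 2"
  have e: "e > 0" "2 * e \<le> h1 - e0" "2 * e \<le> h1 - h2" "2 * e \<le> h3 - h2" "2 * e \<le> h3 - e4"
    using ord by (auto simp: e_def min_def)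
  obtain \<rho> \<xi> where \<rho>: "0 < \<rho>" and n: "norm (\<rho> *\<^sub>R \<xi>) < e"
    and eq: "F (\<rho>, (h1, h2, h3) + \<rho> *\<^sub>R \<xi>) = F (0, (h1, h2, h3))"
    using *[OF e(1)] by blast
  obtain d1 d2 d3 where d: "\<rho> *\<^sub>R \<xi> = (d1, d2, d3)" by (cases "\<rho> *\<^sub>R \<xi>") auto
  have small: "\<bar>d1\<bar> < e" "\<bar>d2\<bar> < e" "\<bar>d3\<bar> < e"
    using n norm_fst_le[of d1 "(d2, d3)"] norm_snd_le[of "(d2, d3)" d1]
      norm_fst_le[of d2 "d3"] norm_snd_le[of d3 d2]
    unfolding d by auto
  have "four_arcs (r + \<rho>) (r + \<rho>) e0 (h1 + d1) (h2 + d2) (h3 + d3) e4 =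
      four_arcs r r e0 h1 h2 h3 e4"
    using eq unfolding four d F_def by simp
  moreover have "r < r + \<rho>" using \<rho> by simp
  moreover have "e0 < h1 + d1" "h2 + d2 < h1 + d1" "h2 + d2 < h3 + d3" "e4 < h3 + d3"
    using small e by linarith+
  ultimately show ?thesis by blast
qed

text \<open>
  The decisive sign in the critical case: the chord of an inner arc, of length \<open>2 sin \<mu>\<close>, against the
  arc length \<open>2 \<mu>\<close> scaled by the cosine of the angle between chord and end tangents.
\<close>
lemma mult_cos_less_sin:
  fixes \<mu> :: real
  assumes "0 < \<mu>" "\<mu> < pi"
  shows "\<mu> * cos \<mu> < sin \<mu>"
proof -
  have "(\<lambda>\<mu>. sin \<mu> - \<mu> * cos \<mu>) 0 < (\<lambda>\<mu>. sin \<mu> - \<mu> * cos \<mu>) \<mu>"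
  proof (rule DERIV_pos_imp_increasing_open[OF assms(1)])
    show "\<exists>y. ((\<lambda>\<mu>. sin \<mu> - \<mu> * cos \<mu>) has_real_derivative y) (at x) \<and> 0 < y"
      if "0 < x" "x < \<mu>" for x
      using that assms sin_gt_zero[of x]
      by (intro exI[of _ "x * sin x"]) (auto intro!: derivative_eq_intros)
  qed (intro continuous_intros)
  then show ?thesis by simp
qed

text \<open>
  The unknowns are \<open>c = cos \<alpha> - 1\<close>, the mean \<open>b\<close> of the headings \<open>b + \<alpha>\<close>, \<open>b - \<alpha>\<close> at the outer switches,
  and the heading at the middle switch. The equations are smooth, and regular, in these unknowns for
  every sign of \<open>c\<close>, but only solutions with \<open>c \<le> 0\<close> correspond to curves. The sign of \<open>c\<close> is
  read off by applying the linear form \<open>n\<close> that vanishes on the tangents at \<open>h\<close> and \<open>k\<close>: it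
  is positive on the coefficient of \<open>c\<close>, so \<open>n\<close> must also be positive on the derivative in the radii.
\<close>
lemma enlarge_critical:
  assumes r: "0 < r" and ord: "e0 < h" "k < h" "e4 < h" and turn: "h - k < 2 * pi"
  shows "\<exists>R S k1 k2 k3. r < R \<and> R \<le> S \<and> e0 < k1 \<and> k2 < k1 \<and> k2 < k3 \<and> e4 < k3 \<and>
    four_arcs R S e0 k1 k2 k3 e4 = four_arcs r r e0 h k h e4"
proof -
  define \<mu> m where "\<mu> = (h - k) / 2" and "m = (h + k) / 2"
  have hk: "h = m + \<mu>" "k = m - \<mu>" by (simp_all add: \<mu>_def m_def field_simps)
  have \<mu>: "0 < \<mu>" "\<mu> < pi" using ord turn by (auto simp: \<mu>_def)
  \<comment> \<open>\<open>(cos m, sin m)\<close> is the direction of the line through the three switching points.\<close>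
  define n where "n v = cos m * fst v + sin m * fst (snd v) - cos \<mu> * snd (snd v)"
    for v :: "real \<times> real \<times> real"
  have n: "linear n" unfolding n_def by (rule linearI) (auto simp: algebra_simps)
  define N where "N b = (sin b, - cos b, 0 :: real)" for b :: real
  have n0: "n (helix' h) = 0" "n (helix' k) = 0"
    using cos_diff[of h m] cos_diff[of k m] by (auto simp: n_def helix'_def hk algebra_simps)
  have nN: "n (N h) = sin \<mu>"
    using sin_diff[of h m] by (simp add: n_def N_def hk algebra_simps)
  have nhk: "n (2 *\<^sub>R helix h - 2 *\<^sub>R helix k) = 4 * (sin \<mu> - \<mu> * cos \<mu>)"
  proof -
    have "n (2 *\<^sub>R helix h - 2 *\<^sub>R helix k) =
       2 * sin (h - m) - 2 * sin (k - m) - 2 * cos \<mu> * (h - k)"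
      unfolding sin_diff by (simp add: n_def helix_def algebra_simps)
    then show ?thesis by (simp add: hk algebra_simps)
  qed
  define W where "W = 2 *\<^sub>R helix h - helix e0 - helix e4"
  have pos: "sin \<mu> - \<mu> * cos \<mu> > 0" "sin \<mu> > 0"
    using mult_cos_less_sin[OF \<mu>] sin_gt_zero[OF \<mu>] by auto
  \<comment> \<open>The outer arcs contribute \<open>n W\<close>, of unknown sign: an outer arc longer than the inner ones crosses
     the line through the switching points. The factor \<open>K\<close> lets the inner arcs outweigh it.\<close>
  define K where "K = 1 + \<bar>n W\<bar> / (4 * (sin \<mu> - \<mu> * cos \<mu>))"
  have K: "K \<ge> 1" using pos by (simp add: K_def)
  have R: "n (W + K *\<^sub>R (2 *\<^sub>R helix h - 2 *\<^sub>R helix k)) > 0"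
  proof -
    have "K * (4 * (sin \<mu> - \<mu> * cos \<mu>)) = 4 * (sin \<mu> - \<mu> * cos \<mu>) + \<bar>n W\<bar>"
      using pos unfolding K_def by (simp add: distrib_right)
    then show ?thesis
      using pos by (simp only: linear_add[OF n] linear_cmul[OF n] nhk) simp
  qed
  define P where "P z = 2 *\<^sub>R helix (fst (snd (snd z))) +
      (2 * fst (snd z)) *\<^sub>R N (fst (snd (snd z)))" for z :: "real \<times> real \<times> real \<times> real"
  define F where "F z = (r + fst z) *\<^sub>R (P z - helix e0 - helix e4) +
      (r + K * fst z) *\<^sub>R (P z - 2 *\<^sub>R helix (snd (snd (snd z))))"
    for z :: "real \<times> real \<times> real \<times> real"
  define M where "M \<xi> = (4 * r) *\<^sub>R fst \<xi> *\<^sub>R N h + (4 * r) *\<^sub>R fst (snd \<xi>) *\<^sub>R helix' h -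
      (2 * r) *\<^sub>R snd (snd \<xi>) *\<^sub>R helix' k" for \<xi> :: "real \<times> real \<times> real"
  have contN: "continuous_on S (\<lambda>z. N (g z))" if "continuous_on S g"
    for S and g :: "real \<times> real \<times> real \<times> real \<Rightarrow> real"
    unfolding N_def by (intro continuous_intros that)
  have derN: "((\<lambda>z. N (g z)) has_derivative (\<lambda>d. g' d *\<^sub>R (cos (g x), sin (g x), 0))) (at x within S)"
    if "(g has_derivative g') (at x within S)"
    for S x and g g' :: "real \<times> real \<times> real \<times> real \<Rightarrow> real"
    unfolding N_def by (auto intro!: derivative_eq_intros that simp: fun_eq_iff mult.commute)
  have cont: "continuous_on UNIV F"
    unfolding F_def P_def by (intro continuous_intros contN)
  have derP: "(P has_derivative (\<lambda>d. (2 * fst (snd (snd d))) *\<^sub>R helix' h + (2 * fst (snd d)) *\<^sub>R N h))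
      (at (0, (0, h, k)))"
    unfolding P_def by (rule derivative_eq_intros derN refl)+ (simp add: fun_eq_iff zero_prod_def)
  have P0: "P (0, (0, h, k)) = 2 *\<^sub>R helix h" by (simp add: P_def)
  have der: "(F has_derivative (\<lambda>(\<delta>, \<xi>). \<delta> *\<^sub>R (W + K *\<^sub>R (2 *\<^sub>R helix h - 2 *\<^sub>R helix k)) + M \<xi>))
      (at (0, (0, h, k)))"
    unfolding F_def W_def M_def
    by (rule derivative_eq_intros derP refl)+ (simp add: fun_eq_iff prod_eq_iff P0 algebra_simps)
  have M: "linear M"
    unfolding M_def by (rule linearI) (auto simp: algebra_simps)
  have nM: "n (M \<xi>) = 4 * r * fst \<xi> * sin \<mu>" for \<xi>
    by (simp add: M_def linear_add[OF n] linear_diff[OF n] linear_cmul[OF n] n0 nN)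
  have "inj M"
  proof (rule iffD2[OF linear_injective_0[OF M]], safe)
    fix \<alpha> \<beta> \<gamma> assume 0: "M (\<alpha>, \<beta>, \<gamma>) = 0"
    have \<alpha>: "\<alpha> = 0" using nM[of "(\<alpha>, \<beta>, \<gamma>)"] 0 pos r by (simp add: linear_0[OF n])
    have 1: "4 * r * \<beta> = 2 * r * \<gamma>" and c: "4 * r * \<beta> * cos h = 2 * r * \<gamma> * cos k"
      and s: "4 * r * \<beta> * sin h = 2 * r * \<gamma> * sin k"
      using 0 by (auto simp: M_def \<alpha> helix'_def zero_prod_def)
    have "2 * r * \<gamma> * cos (h - k) = cos h * (2 * r * \<gamma> * cos k) + sin h * (2 * r * \<gamma> * sin k)"
      unfolding cos_diff by (simp add: algebra_simps)
    also have "\<dots> = 4 * r * \<beta> * ((cos h)\<^sup>2 + (sin h)\<^sup>2)"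
      unfolding c[symmetric] s[symmetric] by (simp only: power2_eq_square distrib_left mult_ac)
    also have "\<dots> = 2 * r * \<gamma>" using 1 by simp
    finally have "2 * r * \<gamma> * (1 - cos (h - k)) = 0" by (simp add: algebra_simps)
    moreover have "cos (h - k) < 1" using cos_less_1[of "h - k"] ord turn by simp
    ultimately have "\<gamma> = 0" using r by simp
    then show "(\<alpha>, \<beta>, \<gamma>) = 0" using \<alpha> 1 r by (simp add: zero_prod_def)
  qed
  then obtain \<xi>0 where \<xi>0: "M \<xi>0 = - (W + K *\<^sub>R (2 *\<^sub>R helix h - 2 *\<^sub>R helix k))"
    and *: "\<And>e. e > 0 \<Longrightarrow> \<exists>\<rho> \<xi>. 0 < \<rho> \<and> \<rho> < e \<and> norm (\<xi> - \<xi>0) < e \<and>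
    norm (\<rho> *\<^sub>R \<xi>) < e \<and> F (\<rho>, (0, h, k) + \<rho> *\<^sub>R \<xi>) = F (0, (0, h, k))"
    using zero_persists_with_slope[OF cont der M] by blast
  \<comment> \<open>Apply \<open>n\<close> to the equation for \<open>\<xi>0\<close>.\<close>
  have c0: "fst \<xi>0 < 0"
  proof -
    have "4 * r * fst \<xi>0 * sin \<mu> < 0"
      using R unfolding nM[symmetric] \<xi>0 by (simp only: linear_neg[OF n] neg_less_0_iff_less)
    then show ?thesis using r pos by (simp add: mult_less_0_iff zero_less_mult_iff)
  qed
  \<comment> \<open>Room for the headings: \<open>g\<close> for \<open>\<alpha>\<close>, and the rest for the two other unknowns. The bound
     \<open>1 - cos g\<close> on \<open>\<bar>c\<bar>\<close> makes \<open>\<alpha> < g\<close>, and \<open>- fst \<xi>0\<close> keeps the slope of \<open>c\<close> negative.\<close>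
  define g where "g = min (min (h - e0) pi) (min (h - k) (h - e4)) / 3"
  have "0 < g" using ord by (simp add: g_def)
  moreover have "3 * g \<le> pi" and g3: "3 * g \<le> h - e0" "3 * g \<le> h - k" "3 * g \<le> h - e4"
    by (simp_all add: g_def min_le_iff_disj)
  ultimately have g: "0 < g" "g < pi" by linarith+
  define e where "e = Min {g, - fst \<xi>0, 1 - cos g}"
  have "cos g < 1" using cos_less_1[of g] g by simp
  then have e: "e > 0" "e \<le> g" "e \<le> - fst \<xi>0" "e \<le> 1 - cos g"
    using g(1) c0 by (auto simp: e_def)
  obtain \<rho> \<xi> where \<rho>: "0 < \<rho>" and n\<xi>: "norm (\<rho> *\<^sub>R \<xi>) < e" "norm (\<xi> - \<xi>0) < e"
    and eq: "F (\<rho>, (0, h, k) + \<rho> *\<^sub>R \<xi>) = F (0, (0, h, k))"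
    using *[OF e(1)] by blast
  obtain c d2 d3 where d: "\<rho> *\<^sub>R \<xi> = (c, d2, d3)" by (cases "\<rho> *\<^sub>R \<xi>") auto
  have small: "\<bar>c\<bar> < e" "\<bar>d2\<bar> < e" "\<bar>d3\<bar> < e"
    using n\<xi>(1) norm_fst_le[of c "(d2, d3)"] norm_snd_le[of "(d2, d3)" c]
      norm_fst_le[of d2 "d3"] norm_snd_le[of d3 d2]
    unfolding d by auto
  have "\<bar>fst \<xi> - fst \<xi>0\<bar> < e"
    using n\<xi>(2) norm_fst_le[of "fst (\<xi> - \<xi>0)" "snd (\<xi> - \<xi>0)", unfolded prod.collapse]
    by simp
  then have "fst \<xi> < 0" using e by linarith
  moreover have "c = \<rho> * fst \<xi>" using d by (metis fst_conv fst_scaleR real_scaleR_def)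
  ultimately have c: "c < 0" using \<rho> by (simp add: mult_pos_neg)
  define \<alpha> where "\<alpha> = arccos (1 + c)"
  have c1: "cos g < 1 + c" using small e by linarith
  have "-1 \<le> 1 + c" using c1 cos_ge_minus_one[of g] by linarith
  then have \<alpha>: "cos \<alpha> = 1 + c" "0 \<le> \<alpha>" "\<alpha> \<le> pi"
    using c by (auto simp: \<alpha>_def intro: cos_arccos arccos_lbound arccos_ubound)
  have "\<alpha> < g"
  proof (rule ccontr)
    assume "\<not> \<alpha> < g"
    then have "cos \<alpha> \<le> cos g" using g \<alpha> by (intro cos_monotone_0_pi_le) auto
    then show False using c1 \<alpha> by simp
  qed
  have sum: "helix (b + \<alpha>) + helix (b - \<alpha>) = 2 *\<^sub>R helix b + (2 * c) *\<^sub>R N b" for b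
    by (simp add: helix_def N_def sin_add sin_diff cos_add cos_diff \<alpha> algebra_simps)
  have four: "four_arcs R S e0 (b + \<alpha>) k' (b - \<alpha>) e4 =
      R *\<^sub>R (2 *\<^sub>R helix b + (2 * c) *\<^sub>R N b - helix e0 - helix e4) +
      S *\<^sub>R (2 *\<^sub>R helix b + (2 * c) *\<^sub>R N b - 2 *\<^sub>R helix k')" for R S b k'
    unfolding sum[symmetric] by (simp add: algebra_simps scaleR_2)
  have "four_arcs (r + \<rho>) (r + K * \<rho>) e0 (h + d2 + \<alpha>) (k + d3) (h + d2 - \<alpha>) e4 =
      F (\<rho>, (0, h, k) + \<rho> *\<^sub>R \<xi>)"
    unfolding d four F_def P_def by simp
  also have "\<dots> = four_arcs r r e0 h k h e4"
    unfolding eq unfolding F_def P_def by (simp add: algebra_simps scaleR_2)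
  finally have "four_arcs (r + \<rho>) (r + K * \<rho>) e0 (h + d2 + \<alpha>) (k + d3) (h + d2 - \<alpha>) e4 =
      four_arcs r r e0 h k h e4" .
  moreover have "r < r + \<rho>" "r + \<rho> \<le> r + K * \<rho>"
    using \<rho> K by auto
  moreover have "e0 < h + d2 + \<alpha>" "k + d3 < h + d2 + \<alpha>" "k + d3 < h + d2 - \<alpha>" "e4 < h + d2 - \<alpha>"
    using small e(2) g3 \<open>\<alpha> < g\<close> \<alpha>(2) by linarith+
  ultimately show ?thesis by blast
qed

lemma enlarge_radius:
  assumes r: "0 < r" and ord: "e0 < h1" "h2 < h1" "h2 < h3" "e4 < h3"
    and turn: "h1 - h2 < 2 * pi" "h3 - h2 < 2 * pi"
  shows "\<exists>R S k1 k2 k3. r < R \<and> R \<le> S \<and> e0 < k1 \<and> k2 < k1 \<and> k2 < k3 \<and> e4 < k3 \<and>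
    four_arcs R S e0 k1 k2 k3 e4 = four_arcs r r e0 h1 h2 h3 e4"
proof (cases "h1 = h3")
  case True
  then show ?thesis using enlarge_critical[OF r] ord turn by metis
next
  case False
  show ?thesis by (rule enlarge_regular[OF r ord turn False])
qed

section \<open>Circular arcs and their concatenations\<close>

text \<open>
  The heading enters through its sine and cosine only, so \<open>p\<close> may be any representative modulo
  \<open>2 * pi\<close> of the heading at the start. This lets the four arcs be chained without lifting angles.
\<close>
lemma arc_endpoints:
  assumes traj: "trajectory T u x y \<theta>" and arc: "circular_arc \<epsilon> r s t x y"
    and st: "0 \<le> s" "t \<le> T" and \<epsilon>: "\<epsilon> = 1 \<or> \<epsilon> = -1"
    and p: "cos (\<theta> s) = cos p" "sin (\<theta> s) = sin p"
  shows "cos (\<theta> t) = cos (p + \<epsilon> * (t - s) / r)" "sin (\<theta> t) = sin (p + \<epsilon> * (t - s) / r)"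
    "x t - x s = \<epsilon> * r * (sin (p + \<epsilon> * (t - s) / r) - sin p)"
    "y t - y s = \<epsilon> * r * (cos p - cos (p + \<epsilon> * (t - s) / r))"
proof -
  from arc have r: "0 < r" "s < t" unfolding circular_arc_def by auto
  from arc obtain cx cy \<phi> where
    ax: "\<And>\<tau>. \<tau> \<in> {s..t} \<Longrightarrow> x \<tau> = cx + r * cos (\<phi> + \<epsilon> * (\<tau> - s) / r)" and
    ay: "\<And>\<tau>. \<tau> \<in> {s..t} \<Longrightarrow> y \<tau> = cy + r * sin (\<phi> + \<epsilon> * (\<tau> - s) / r)"
    unfolding circular_arc_def by blast
  have ay': "y \<tau> = cy + r * cos ((\<phi> - pi / 2) + \<epsilon> * (\<tau> - s) / r)" if "\<tau> \<in> {s..t}" for \<tau>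
  proof -
    have "cos ((\<phi> - pi / 2) + z) = sin (\<phi> + z)" for z
      by (simp add: sin_add cos_add sin_diff cos_diff)
    then show ?thesis using ay[OF that] by simp
  qed
  have D: "cos (\<theta> \<tau>) = - \<epsilon> * sin (\<phi> + \<epsilon> * (\<tau> - s) / r)"
    "sin (\<theta> \<tau>) = \<epsilon> * cos (\<phi> + \<epsilon> * (\<tau> - s) / r)" if \<tau>: "\<tau> \<in> {s..t}" for \<tau>
  proof -
    have "\<tau> \<in> {0..T}" using \<tau> st by auto
    then have dx: "(x has_real_derivative cos (\<theta> \<tau>)) (at \<tau> within {0..T})"
      and dy: "(y has_real_derivative sin (\<theta> \<tau>)) (at \<tau> within {0..T})"
      using traj unfolding trajectory_def by blast+
    show "cos (\<theta> \<tau>) = - \<epsilon> * sin (\<phi> + \<epsilon> * (\<tau> - s) / r)"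
      by (rule arc_derivative[OF r st(2,1) ax dx \<tau>])
    have "sin (\<theta> \<tau>) = - \<epsilon> * sin ((\<phi> - pi / 2) + \<epsilon> * (\<tau> - s) / r)"
      by (rule arc_derivative[OF r st(2,1) ay' dy \<tau>])
    moreover have "sin ((\<phi> - pi / 2) + z) = - cos (\<phi> + z)" for z
      by (simp add: sin_add cos_add sin_diff cos_diff)
    ultimately show "sin (\<theta> \<tau>) = \<epsilon> * cos (\<phi> + \<epsilon> * (\<tau> - s) / r)" by simp
  qed
  have c: "cos p = - \<epsilon> * sin \<phi>" and s: "sin p = \<epsilon> * cos \<phi>"
    using D[of s] r p by simp_all
  have C: "cos (p + z) = - \<epsilon> * sin (\<phi> + z)" and S: "sin (p + z) = \<epsilon> * cos (\<phi> + z)" for z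
    unfolding cos_add sin_add c s by (simp_all add: algebra_simps)
  show "cos (\<theta> t) = cos (p + \<epsilon> * (t - s) / r)" "sin (\<theta> t) = sin (p + \<epsilon> * (t - s) / r)"
    using D[of t] r C S by simp_all
  have "\<epsilon> * \<epsilon> = 1" using \<epsilon> by auto
  then have e: "\<epsilon> * (\<epsilon> * z) = z" for z by (simp flip: mult.assoc)
  show "x t - x s = \<epsilon> * r * (sin (p + \<epsilon> * (t - s) / r) - sin p)"
    unfolding S s using ax[of t] ax[of s] r by (simp add: algebra_simps e)
  show "y t - y s = \<epsilon> * r * (cos p - cos (p + \<epsilon> * (t - s) / r))"
    unfolding C c using ay[of t] ay[of s] r by (simp add: algebra_simps e)
qed

text \<open>
  The possible displacements \<open>D\<close> on a curve of length \<open>L\<close> and curvature at most \<open>b\<close> whose heading goes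
  from \<open>p\<close> to \<open>q\<close>. Displacements are used instead of positions, exact headings instead of
  classes modulo \<open>2 * pi\<close>, and Borel controls on the whole line, so that curves can be concatenated.
\<close>
definition steerable :: "real \<Rightarrow> real \<Rightarrow> real \<Rightarrow> real \<Rightarrow> real \<times> real \<Rightarrow> bool" where
  "steerable b p q L D \<longleftrightarrow> 0 \<le> L \<and>
     (\<exists>u \<theta>. u \<in> borel_measurable borel \<and> (\<forall>t. \<bar>u t\<bar> \<le> b) \<and>
        continuous_on {0..L} \<theta> \<and> \<theta> 0 = p \<and> \<theta> L = q \<and>
        (\<forall>t\<in>{0..L}. (u has_integral (\<theta> t - p)) {0..t}) \<and>
        ((\<lambda>t. (cos (\<theta> t), sin (\<theta> t))) has_integral D) {0..L})"

lemma steerable_arc: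
  assumes k: "k \<noteq> 0" "\<bar>k\<bar> \<le> b" and L: "0 \<le> L"
  shows "steerable b p (p + k * L) L
    ((sin (p + k * L) - sin p) / k, (cos p - cos (p + k * L)) / k)"
proof -
  have "((\<lambda>_. k) has_integral (p + k * t - p)) {0..t}" if "t \<ge> 0" for t
    using has_integral_const_real[of k 0 t] that by (simp add: mult.commute)
  moreover have "((\<lambda>t. (cos (p + k * t), sin (p + k * t))) has_integral
    ((sin (p + k * L) / k, - cos (p + k * L) / k) - (sin (p + k * 0) / k, - cos (p + k * 0) / k))) {0..L}"
    using k by (intro fundamental_theorem_of_calculus L)
      (auto intro!: derivative_eq_intros has_vector_derivative_Pair
        simp: has_real_derivative_iff_has_vector_derivative[symmetric])
  ultimately show ?thesis unfolding steerable_def using k L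
    by (intro conjI exI[of _ "\<lambda>_. k"] exI[of _ "\<lambda>t. p + k * t"])
      (auto intro!: continuous_intros simp: diff_divide_distrib)
qed

lemma has_integral_shift_right:
  fixes f :: "real \<Rightarrow> 'a::euclidean_space"
  assumes "(f has_integral I) {0..t}"
  shows "((\<lambda>s. f (s - c)) has_integral I) {c..c + t}"
  using has_integral_affinity[of f I 0 t 1 "- c"] assms
  by (simp add: image_add_atLeastAtMost' add.commute)

lemma steerable_append:
  assumes 1: "steerable b p q L D" and 2: "steerable b q q' L' D'"
  shows "steerable b p q' (L + L') (D + D')"
proof -
  obtain u \<theta> where L: "0 \<le> L" and u: "u \<in> borel_measurable borel" "\<And>t. \<bar>u t\<bar> \<le> b"
    and \<theta>: "continuous_on {0..L} \<theta>" "\<theta> 0 = p" "\<theta> L = q"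
    and iu: "\<And>t. t \<in> {0..L} \<Longrightarrow> (u has_integral (\<theta> t - p)) {0..t}"
    and iD: "((\<lambda>t. (cos (\<theta> t), sin (\<theta> t))) has_integral D) {0..L}"
    using 1 unfolding steerable_def by blast
  obtain u' \<theta>' where L': "0 \<le> L'" and u': "u' \<in> borel_measurable borel" "\<And>t. \<bar>u' t\<bar> \<le> b"
    and \<theta>': "continuous_on {0..L'} \<theta>'" "\<theta>' 0 = q" "\<theta>' L' = q'"
    and iu': "\<And>t. t \<in> {0..L'} \<Longrightarrow> (u' has_integral (\<theta>' t - q)) {0..t}"
    and iD': "((\<lambda>t. (cos (\<theta>' t), sin (\<theta>' t))) has_integral D') {0..L'}"
    using 2 unfolding steerable_def by blast
  define v where "v t = (if t < L then u t else u' (t - L))" for t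
  define \<psi> where "\<psi> t = (if t \<le> L then \<theta> t else \<theta>' (t - L))" for t
  have \<psi>2: "\<psi> t = \<theta>' (t - L)" if "t \<ge> L" for t
    using that \<theta>(3) \<theta>'(2) by (cases "t = L") (auto simp: \<psi>_def)
  have v: "v \<in> borel_measurable borel"
    unfolding v_def using u(1) u'(1) by measurable
  have "continuous_on ({0..L} \<union> {L..L + L'}) \<psi>"
    unfolding \<psi>_def
  proof (rule continuous_on_If)
    show "continuous_on {L..L + L'} (\<lambda>t. \<theta>' (t - L))"
      by (rule continuous_on_compose2[OF \<theta>'(1)]) (auto intro!: continuous_intros)
  qed (use \<theta> \<theta>'(2) in \<open>auto\<close>)
  then have c: "continuous_on {0..L + L'} \<psi>"
    using L L' by (simp add: ivl_disj_un_two_touch)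
  have iv: "(v has_integral (\<psi> t - p)) {0..t}" if t: "t \<in> {0..L + L'}" for t
  proof -
    have first: "(v has_integral (\<theta> s - p)) {0..s}" if "s \<in> {0..L}" for s
      by (rule has_integral_spike_finite[of "{L}" _ _ u, OF _ _ iu[OF that]]) (use that in \<open>auto simp: v_def\<close>)
    show ?thesis
    proof (cases "t \<le> L")
      case True
      then show ?thesis using first t by (simp add: \<psi>_def)
    next
      case False
      have "((\<lambda>s. u' (s - L)) has_integral (\<theta>' (t - L) - q)) {L..L + (t - L)}"
        using False t by (intro has_integral_shift_right iu') auto
      then have "(v has_integral (\<theta>' (t - L) - q)) {L..t}"
        using has_integral_cong[of "{L..t}" v "\<lambda>s. u' (s - L)"] by (simp add: v_def)
      then have "(v has_integral ((\<theta> L - p) + (\<theta>' (t - L) - q))) {0..t}"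
        using False L by (intro has_integral_combine[OF _ _ first]) auto
      then show ?thesis using False \<theta>(3) by (simp add: \<psi>_def)
    qed
  qed
  have "((\<lambda>t. (cos (\<psi> t), sin (\<psi> t))) has_integral D) {0..L}"
    by (rule has_integral_eq[OF _ iD]) (auto simp: \<psi>_def)
  moreover have "((\<lambda>t. (cos (\<psi> t), sin (\<psi> t))) has_integral D') {L..L + L'}"
    by (rule has_integral_eq[OF _ has_integral_shift_right[OF iD']]) (auto simp: \<psi>2)
  ultimately have "((\<lambda>t. (cos (\<psi> t), sin (\<psi> t))) has_integral D + D') {0..L + L'}"
    using L L' by (intro has_integral_combine) auto
  then show ?thesis
    unfolding steerable_def using L L' v c iv u(2) u'(2) \<theta>(2) \<theta>'(3) \<psi>2[of "L + L'"]
    by (intro conjI exI[of _ v] exI[of _ \<psi>]) (auto simp: v_def \<psi>_def)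
qed

lemma Pc_admissible_if_steerable:
  assumes st: "steerable b p q T (xf - x0, yf - y0)"
    and p: "[p = \<theta>0] (rmod (2 * pi))" and q: "[q = \<theta>f] (rmod (2 * pi))"
  shows "\<exists>u. Pc_admissible T (x0, y0, \<theta>0) (xf, yf, \<theta>f) b u"
proof -
  obtain u \<theta> where T: "0 \<le> T" and u: "u \<in> borel_measurable borel" "\<And>t. \<bar>u t\<bar> \<le> b"
    and \<theta>: "continuous_on {0..T} \<theta>" "\<theta> 0 = p" "\<theta> T = q"
    and iu: "\<And>t. t \<in> {0..T} \<Longrightarrow> (u has_integral (\<theta> t - p)) {0..t}"
    and iD: "((\<lambda>t. (cos (\<theta> t), sin (\<theta> t))) has_integral (xf - x0, yf - y0)) {0..T}"
    using st unfolding steerable_def by blast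
  define x y where "x t = x0 + integral {0..t} (\<lambda>t. cos (\<theta> t))"
    and "y t = y0 + integral {0..t} (\<lambda>t. sin (\<theta> t))" for t
  have "(x has_real_derivative cos (\<theta> t)) (at t within {0..T})"
    "(y has_real_derivative sin (\<theta> t)) (at t within {0..T})" if "t \<in> {0..T}" for t
    unfolding x_def y_def
    using integral_has_real_derivative[OF continuous_on_cos[OF \<theta>(1)] that]
      integral_has_real_derivative[OF continuous_on_sin[OF \<theta>(1)] that]
    by (auto intro!: derivative_eq_intros)
  moreover have "u \<in> borel_measurable (lebesgue_on {0..T})"
    using u(1) by (intro measurable_restrict_space1 measurable_completion) simp
  ultimately have "trajectory T u x y \<theta>"
    unfolding trajectory_def using u(2) iu \<theta>(2) by (auto intro!: exI[of _ b])
  moreover have "((\<lambda>t. cos (\<theta> t)) has_integral xf - x0) {0..T}"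
    "((\<lambda>t. sin (\<theta> t)) has_integral yf - y0) {0..T}"
    using has_integral_linear[OF iD bounded_linear_fst] has_integral_linear[OF iD bounded_linear_snd]
    by (simp_all add: o_def)
  then have "x T = xf" "y T = yf"
    by (simp_all add: x_def y_def integral_unique)
  moreover have "x 0 = x0" "y 0 = y0" by (simp_all add: x_def y_def)
  moreover have "0 \<le> b" using u(2)[of 0] by linarith
  ultimately have "Pc_admissible T (x0, y0, \<theta>0) (xf, yf, \<theta>f) b u"
    unfolding Pc_admissible_def prod.case using u(2) p q \<theta>(2,3) by blast
  then show ?thesis by blast
qed

section \<open>Improving four alternating arcs\<close>

text \<open>
  The sign \<open>\<epsilon>\<close> reflects a right-left-right-left curve in the \<open>x\<close>-axis, so that the first arc is a left
  turn; headings and \<open>y\<close> change sign. The last heading \<open>h4\<close> is the one obtained by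
  following the arcs, so \<open>\<epsilon> * h4\<close> represents \<open>\<theta> T\<close> modulo \<open>2 * pi\<close>.
\<close>
lemma CCCC_endpoints:
  assumes "CCCC_trajectory T a u x y \<theta>"
  obtains \<epsilon> h1 h2 h3 h4 where "\<epsilon> = 1 \<or> \<epsilon> = -1"
    "\<epsilon> * \<theta> 0 < h1" "h2 < h1" "h2 < h3" "h4 < h3" "h1 - h2 < 2 * pi" "h3 - h2 < 2 * pi"
    "cos (\<epsilon> * h4) = cos (\<theta> T)" "sin (\<epsilon> * h4) = sin (\<theta> T)"
    "four_arcs (1 / a) (1 / a) (\<epsilon> * \<theta> 0) h1 h2 h3 h4 = (x T - x 0, \<epsilon> * (y T - y 0), T)"
proof -
  define r where "r = 1 / a"
  obtain \<epsilon> s1 s2 s3 where tr: "trajectory T u x y \<theta>" and a: "0 < a" and \<epsilon>: "\<epsilon> = 1 \<or> \<epsilon> = -1"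
    and c: "circular_arc \<epsilon> r 0 s1 x y" "circular_arc (- \<epsilon>) r s1 s2 x y"
      "circular_arc \<epsilon> r s2 s3 x y" "circular_arc (- \<epsilon>) r s3 T x y"
    using assms unfolding CCCC_trajectory_def r_def by blast
  have r: "r > 0" using a by (simp add: r_def)
  have s: "0 < s1" "s1 < s2" "s2 < s3" "s3 < T" and
    turn: "(s2 - s1) / r < 2 * pi" "(s3 - s2) / r < 2 * pi"
    using c unfolding circular_arc_def by auto
  have \<epsilon>': "- \<epsilon> = 1 \<or> - \<epsilon> = -1" and ee: "\<epsilon> * \<epsilon> = 1" using \<epsilon> by auto
  define h0 h1 h2 h3 h4 where "h0 = \<epsilon> * \<theta> 0" and "h1 = h0 + s1 / r" and
    "h2 = h1 - (s2 - s1) / r" and "h3 = h2 + (s3 - s2) / r" and "h4 = h3 - (T - s3) / r"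
  note h = h1_def h2_def h3_def h4_def
  have arg: "\<theta> 0 + \<epsilon> * (s1 - 0) / r = \<epsilon> * h1" "\<epsilon> * h1 + - \<epsilon> * (s2 - s1) / r = \<epsilon> * h2"
    "\<epsilon> * h2 + \<epsilon> * (s3 - s2) / r = \<epsilon> * h3" "\<epsilon> * h3 + - \<epsilon> * (T - s3) / r = \<epsilon> * h4"
    using ee by (simp_all add: h h0_def distrib_left right_diff_distrib diff_divide_distrib flip: mult.assoc)
  have p1: "cos (\<theta> s1) = cos (\<epsilon> * h1)" "sin (\<theta> s1) = sin (\<epsilon> * h1)"
    "x s1 - x 0 = \<epsilon> * r * (sin (\<epsilon> * h1) - sin (\<epsilon> * h0))"
    "y s1 - y 0 = \<epsilon> * r * (cos (\<epsilon> * h0) - cos (\<epsilon> * h1))"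
    using arc_endpoints[OF tr c(1) _ _ \<epsilon> refl refl, unfolded arg] s ee
    by (simp_all add: h0_def flip: mult.assoc)
  note p2 = arc_endpoints[OF tr c(2) _ _ \<epsilon>' p1(1,2), unfolded arg]
  note p3 = arc_endpoints[OF tr c(3) _ _ \<epsilon> p2(1,2), unfolded arg]
  note p4 = arc_endpoints[OF tr c(4) _ _ \<epsilon>' p3(1,2), unfolded arg]
  have sn: "\<epsilon> * (z * sin (\<epsilon> * h)) = z * sin h" and cs: "cos (\<epsilon> * h) = cos h" for z h
    using \<epsilon> by auto
  have X: "x s2 - x s1 = r * (sin h1 - sin h2)" "x s1 - x 0 = r * (sin h1 - sin h0)"
    "x s3 - x s2 = r * (sin h3 - sin h2)" "x T - x s3 = r * (sin h3 - sin h4)"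
    using p1(3) p2(3) p3(3) p4(3) s by (simp_all add: right_diff_distrib sn mult.assoc)
  have Y: "\<epsilon> * (y s2 - y s1) = r * (cos h2 - cos h1)" "\<epsilon> * (y s1 - y 0) = r * (cos h0 - cos h1)"
    "\<epsilon> * (y s3 - y s2) = r * (cos h2 - cos h3)" "\<epsilon> * (y T - y s3) = r * (cos h4 - cos h3)"
    using p1(4) p2(4) p3(4) p4(4) s ee
    by (simp_all add: cs right_diff_distrib flip: mult.assoc)
  have Z: "s1 = r * (h1 - h0)" "s2 - s1 = r * (h1 - h2)" "s3 - s2 = r * (h3 - h2)"
    "T - s3 = r * (h3 - h4)"
    using r by (simp_all add: h)
  have "x T - x 0 = r * (sin h1 - sin h0) + r * (sin h1 - sin h2) + r * (sin h3 - sin h2) +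
      r * (sin h3 - sin h4)"
    unfolding X[symmetric] by simp
  moreover have "\<epsilon> * (y T - y 0) = r * (cos h0 - cos h1) + r * (cos h2 - cos h1) +
      r * (cos h2 - cos h3) + r * (cos h4 - cos h3)"
    unfolding Y[symmetric] by (simp add: algebra_simps)
  moreover have "T = r * (h1 - h0) + r * (h1 - h2) + r * (h3 - h2) + r * (h3 - h4)"
    unfolding Z[symmetric] by simp
  ultimately have "four_arcs r r h0 h1 h2 h3 h4 = (x T - x 0, \<epsilon> * (y T - y 0), T)"
    by (simp add: helix_def)
  moreover have "h0 < h1" "h2 < h1" "h2 < h3" "h4 < h3" "h1 - h2 < 2 * pi" "h3 - h2 < 2 * pi"
    using s turn r by (simp_all add: h)
  moreover have "cos (\<epsilon> * h4) = cos (\<theta> T)" "sin (\<epsilon> * h4) = sin (\<theta> T)"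
    using p4(1,2) s by simp_all
  ultimately show ?thesis using that \<epsilon> unfolding h0_def r_def by blast
qed

text \<open>
  A left and a right turn in reflected headings, in the form of the summands of \<open>four_arcs\<close>.
\<close>
lemma steerable_left_right:
  assumes \<epsilon>: "\<epsilon> = 1 \<or> \<epsilon> = -1" and r: "0 < r" "1 / r \<le> b"
  shows "p \<le> q \<Longrightarrow> steerable b (\<epsilon> * p) (\<epsilon> * q) (r * (q - p))
      (r * (sin q - sin p), \<epsilon> * (r * (cos p - cos q)))"
    and "q \<le> p \<Longrightarrow> steerable b (\<epsilon> * p) (\<epsilon> * q) (r * (p - q))
      (r * (sin p - sin q), \<epsilon> * (r * (cos q - cos p)))"
proof -
  have *: "steerable b (\<epsilon> * p) (\<epsilon> * q) (r * (\<sigma> * (q - p)))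
      (\<sigma> * r * (sin q - sin p), \<epsilon> * \<sigma> * (r * (cos p - cos q)))"
    if "\<sigma> = 1 \<or> \<sigma> = -1" "0 \<le> \<sigma> * (q - p)" for \<sigma>
    using steerable_arc[of "\<epsilon> * \<sigma> / r" b "r * (\<sigma> * (q - p))" "\<epsilon> * p"] that \<epsilon> r
    by (auto simp: algebra_simps)
  show "p \<le> q \<Longrightarrow> steerable b (\<epsilon> * p) (\<epsilon> * q) (r * (q - p))
      (r * (sin q - sin p), \<epsilon> * (r * (cos p - cos q)))"
    using *[of 1] by simp
  show "q \<le> p \<Longrightarrow> steerable b (\<epsilon> * p) (\<epsilon> * q) (r * (p - q))
      (r * (sin p - sin q), \<epsilon> * (r * (cos q - cos p)))"
    using *[of "-1"] by (simp add: algebra_simps)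
qed

lemma steerable_four_arcs:
  assumes \<epsilon>: "\<epsilon> = 1 \<or> \<epsilon> = -1" and R: "0 < R" "R \<le> S"
    and ord: "h0 < h1" "h2 < h1" "h2 < h3" "h4 < h3"
    and eq: "four_arcs R S h0 h1 h2 h3 h4 = (X, \<epsilon> * Y, T)"
  shows "steerable (1 / R) (\<epsilon> * h0) (\<epsilon> * h4) T (X, Y)"
proof -
  have S: "0 < S" "1 / S \<le> 1 / R" using R by (auto simp: field_simps)
  have ee: "\<epsilon> * (\<epsilon> * z) = z" for z using \<epsilon> by auto
  have "\<epsilon> * Y = R * (cos h0 - cos h1) + S * (cos h2 - cos h1) + S * (cos h2 - cos h3) +
      R * (cos h4 - cos h3)"
    using eq by (simp add: helix_def)
  then have Y: "Y = \<epsilon> * (R * (cos h0 - cos h1) + S * (cos h2 - cos h1) + S * (cos h2 - cos h3) +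
      R * (cos h4 - cos h3))"
    using ee[of Y] by metis
  have X: "X = R * (sin h1 - sin h0) + S * (sin h1 - sin h2) + S * (sin h3 - sin h2) +
      R * (sin h3 - sin h4)"
    and T: "T = R * (h1 - h0) + S * (h1 - h2) + S * (h3 - h2) + R * (h3 - h4)"
    using eq by (simp_all add: helix_def)
  show ?thesis
    unfolding X Y T distrib_left
    using steerable_append[OF steerable_append[OF steerable_append[OF
    steerable_left_right(1)[OF \<epsilon> R(1) order_refl less_imp_le[OF ord(1)]]
    steerable_left_right(2)[OF \<epsilon> S less_imp_le[OF ord(2)]]]
    steerable_left_right(1)[OF \<epsilon> S less_imp_le[OF ord(3)]]]
    steerable_left_right(2)[OF \<epsilon> R(1) order_refl less_imp_le[OF ord(4)]]]
    by (simp only: add_Pair)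
qed

theorem lemma20:
  fixes T a :: real and u x y \<theta> :: "real \<Rightarrow> real"
  assumes "CCCC_trajectory T a u x y \<theta>"
  shows "\<not> Pc_solution T (x 0, y 0, \<theta> 0) (x T, y T, \<theta> T) a u"
proof
  assume sol: "Pc_solution T (x 0, y 0, \<theta> 0) (x T, y T, \<theta> T) a u"
  have a: "0 < a" using assms by (simp add: CCCC_trajectory_def)
  obtain \<epsilon> h1 h2 h3 h4 where \<epsilon>: "\<epsilon> = 1 \<or> \<epsilon> = -1"
    and ord: "\<epsilon> * \<theta> 0 < h1" "h2 < h1" "h2 < h3" "h4 < h3"
    and turn: "h1 - h2 < 2 * pi" "h3 - h2 < 2 * pi"
    and last: "cos (\<epsilon> * h4) = cos (\<theta> T)" "sin (\<epsilon> * h4) = sin (\<theta> T)"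
    and eq: "four_arcs (1 / a) (1 / a) (\<epsilon> * \<theta> 0) h1 h2 h3 h4 = (x T - x 0, \<epsilon> * (y T - y 0), T)"
    using CCCC_endpoints[OF assms] .
  have "0 < 1 / a" using a by simp
  obtain R S k1 k2 k3 where R: "1 / a < R" "R \<le> S"
    and k: "\<epsilon> * \<theta> 0 < k1" "k2 < k1" "k2 < k3" "h4 < k3"
    and eq': "four_arcs R S (\<epsilon> * \<theta> 0) k1 k2 k3 h4 = (x T - x 0, \<epsilon> * (y T - y 0), T)"
    using enlarge_radius[OF \<open>0 < 1 / a\<close> ord turn] unfolding eq by blast
  have R0: "0 < R" using R(1) a by (meson less_trans zero_less_divide_1_iff)
  have "steerable (1 / R) (\<epsilon> * (\<epsilon> * \<theta> 0)) (\<epsilon> * h4) T (x T - x 0, y T - y 0)"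
    by (rule steerable_four_arcs[OF \<epsilon> R0 R(2) k eq'])
  moreover have "\<epsilon> * (\<epsilon> * \<theta> 0) = \<theta> 0" using \<epsilon> by auto
  moreover have "[\<epsilon> * h4 = \<theta> T] (rmod (2 * pi))"
  proof -
    obtain n :: int where "\<theta> T = \<epsilon> * h4 + 2 * pi * n"
      using last sin_cos_eq_iff[of "\<theta> T" "\<epsilon> * h4"] by auto
    then show ?thesis unfolding rcong_altdef by (auto simp: mult.commute)
  qed
  ultimately obtain v where "Pc_admissible T (x 0, y 0, \<theta> 0) (x T, y T, \<theta> T) (1 / R) v"
    using Pc_admissible_if_steerable[OF _ rcong_refl] by metis
  then have "a \<le> 1 / R" using sol unfolding Pc_solution_def by blast
  then show False using R(1) R0 a by (simp add: field_simps)
qed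

end
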